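(* Let $X$ be a heap. Then for every $n\ge 1$ the ternary self-distributive homology of $X$ satisfies $$H_n^{\rm SD}(X)\cong H_n^{\rm DH}(X)\oplus H_n^{\rm NDH}(X).$$
   Context: A heap is a non-empty set $X$ with a ternary operation $[x,y,z]$ satisfying $[[x_1,x_2,x_3],x_4,x_5]=[x_1,[x_4,x_3,x_2],x_5]=[x_1,x_2,[x_3,x_4,x_5]]$ and $[x,x,y]=y$, $[x,y,y]=x$; e.g. a group with $[x,y,z]=xy^{-1}z$ (every heap arises from a group structure on the same set in this way), and accordingly we write $xy^{-1}z$ for $[x,y,z]$. For $n\ge1$, $C_n^{\rm SD}(X)$ is the free abelian group generated by $(2n-1)$-tuples $(x_1,\dots,x_{2n-1})$ of elements of $X$, with boundary $d_n:C_n^{\rm SD}(X)\to C_{n-1}^{\rm SD}(X)$ (with $d_1=0$) $$d_n(x_1,\dots,x_{2n-1})=\sum_{i=1}^{n-1}(-1)^i\big[(x_1,\dots,\widehat{x_{2i},x_{2i+1}},\dots,x_{2n-1})-(x_1x_{2i}^{-1}x_{2i+1},\dots,x_{2i-1}x_{2i}^{-1}x_{2i+1},\widehat{x_{2i},x_{2i+1}},x_{2i+2},\dots,x_{2n-1})\big],$$ where hats denote omission. Its homology is $H_n^{\rm SD}(X)$. The degenerate subcomplex $C_n^{\rm DH}(X)$ is generated by the tuples with $x_{2i}=x_{2i+1}$ for some $i\in\{1,\dots,n-1\}$, and the nondegenerate subcomplex $C_n^{\rm NDH}(X)$ is generated by the tuples with $x_{2i}\ne x_{2i+1}$ for all $i=1,\dots,n-1$;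 both are equipped with the restriction of $d_n$, and their homologies are $H_n^{\rm DH}(X)$ and $H_n^{\rm NDH}(X)$. *)

theory Defs
  imports "HOL-Algebra.Free_Abelian_Groups"
begin

locale heap =
  fixes X :: "'a set" and t :: "'a \<Rightarrow> 'a \<Rightarrow> 'a \<Rightarrow> 'a"
  assumes nonempty: "X \<noteq> {}"
    and closed: "\<lbrakk>x \<in> X; y \<in> X; z \<in> X\<rbrakk> \<Longrightarrow> t x y z \<in> X"
    and assoc_left: "\<lbrakk>x1 \<in> X; x2 \<in> X; x3 \<in> X; x4 \<in> X; x5 \<in> X\<rbrakk> \<Longrightarrow>
      t (t x1 x2 x3) x4 x5 = t x1 (t x4 x3 x2) x5"
    and assoc_right: "\<lbrakk>x1 \<in> X; x2 \<in> X; x3 \<in> X; x4 \<in> X; x5 \<in> X\<rbrakk> \<Longrightarrow>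
      t x1 (t x4 x3 x2) x5 = t x1 x2 (t x3 x4 x5)"
    and cancel_left: "\<lbrakk>x \<in> X; y \<in> X\<rbrakk> \<Longrightarrow> t x x y = y"
    and cancel_right: "\<lbrakk>x \<in> X; y \<in> X\<rbrakk> \<Longrightarrow> t x y y = x"

(* Written additively to avoid truncated subtraction: the length is 2n - 1, and
   for n = 0 there are no tuples, so that the chain group in degree 0 is trivial. *)
definition SD_tuples :: "'a set \<Rightarrow> nat \<Rightarrow> 'a list set" where
  "SD_tuples X n = {xs. length xs + 1 = 2 * n \<and> set xs \<subseteq> X}"

(* Tuples (x_1, ..., x_{2n-1}) are 1-based in the mathematics, lists are 0-based. *)
abbreviation entry :: "'a list \<Rightarrow> nat \<Rightarrow> 'a" where
  "entry xs j \<equiv> xs ! (j - 1)"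

(* The tuple with x_{2i} and x_{2i+1} omitted. *)
definition omit_face :: "nat \<Rightarrow> 'a list \<Rightarrow> 'a list" where
  "omit_face i xs = take (2 * i - 1) xs @ drop (2 * i + 1) xs"

(* The same omission, with each x_j for j \<le> 2i-1 replaced by [x_j, x_{2i}, x_{2i+1}]. *)
definition act_face :: "('a \<Rightarrow> 'a \<Rightarrow> 'a \<Rightarrow> 'a) \<Rightarrow> nat \<Rightarrow> 'a list \<Rightarrow> 'a list" where
  "act_face t i xs =
     map (\<lambda>x. t x (entry xs (2 * i)) (entry xs (2 * i + 1))) (take (2 * i - 1) xs)
     @ drop (2 * i + 1) xs"

definition SD_boundary ::
  "('a \<Rightarrow> 'a \<Rightarrow> 'a \<Rightarrow> 'a) \<Rightarrow> nat \<Rightarrow> ('a list \<Rightarrow>\<^sub>0 int) \<Rightarrow> ('a list \<Rightarrow>\<^sub>0 int)" where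
  "SD_boundary t n = frag_extend (\<lambda>xs. \<Sum>i = 1..n - 1.
     frag_cmul ((-1) ^ i) (frag_of (omit_face i xs) - frag_of (act_face t i xs)))"

definition SD_chain :: "'a set \<Rightarrow> nat \<Rightarrow> ('a list \<Rightarrow>\<^sub>0 int) monoid" where
  "SD_chain X n = free_Abelian_group (SD_tuples X n)"

definition DH_chain :: "'a set \<Rightarrow> nat \<Rightarrow> ('a list \<Rightarrow>\<^sub>0 int) monoid" where
  "DH_chain X n = subgroup_generated (SD_chain X n)
     (frag_of ` {xs \<in> SD_tuples X n. \<exists>i\<in>{1..n - 1}. entry xs (2 * i) = entry xs (2 * i + 1)})"

definition NDH_chain :: "'a set \<Rightarrow> nat \<Rightarrow> ('a list \<Rightarrow>\<^sub>0 int) monoid" where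
  "NDH_chain X n = subgroup_generated (SD_chain X n)
     (frag_of ` {xs \<in> SD_tuples X n. \<forall>i\<in>{1..n - 1}. entry xs (2 * i) \<noteq> entry xs (2 * i + 1)})"

(* ker (d n) / im (d (n + 1)), for d restricted to the groups C n. *)
definition homology ::
  "(nat \<Rightarrow> ('c, 'm) monoid_scheme) \<Rightarrow> (nat \<Rightarrow> 'c \<Rightarrow> 'c) \<Rightarrow> nat \<Rightarrow> 'c set monoid" where
  "homology C d n =
     subgroup_generated (C n) (kernel (C n) (C (n - 1)) (d n)) Mod (d (n + 1) ` carrier (C (n + 1)))"

definition SD_homology :: "'a set \<Rightarrow> ('a \<Rightarrow> 'a \<Rightarrow> 'a \<Rightarrow> 'a) \<Rightarrow> nat \<Rightarrow> ('a list \<Rightarrow>\<^sub>0 int) set monoid" where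
  "SD_homology X t = homology (SD_chain X) (SD_boundary t)"

definition DH_homology :: "'a set \<Rightarrow> ('a \<Rightarrow> 'a \<Rightarrow> 'a \<Rightarrow> 'a) \<Rightarrow> nat \<Rightarrow> ('a list \<Rightarrow>\<^sub>0 int) set monoid" where
  "DH_homology X t = homology (DH_chain X) (SD_boundary t)"

definition NDH_homology :: "'a set \<Rightarrow> ('a \<Rightarrow> 'a \<Rightarrow> 'a \<Rightarrow> 'a) \<Rightarrow> nat \<Rightarrow> ('a list \<Rightarrow>\<^sub>0 int) set monoid" where
  "NDH_homology X t = homology (NDH_chain X) (SD_boundary t)"

end

theory Submission
  imports Defs
begin

text \<open>The set of generators splits into degenerate and nondegenerate tuples, and both spans are
  stable under the boundary. In a degenerate tuple the two faces at an index \<open>i\<close> with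
  \<open>x\<^sub>2\<^sub>i = x\<^sub>2\<^sub>i\<^sub>+\<^sub>1\<close> cancel because \<open>[x, y, y] = x\<close>, and all other faces keep the equality; in a
  nondegenerate tuple all faces stay nondegenerate because right translations of a heap are
  injective. So the chain complex is a direct sum, and homology commutes with direct sums.\<close>

section \<open>Projections of a free abelian group onto the span of some generators\<close>

text \<open>The projection that kills all generators outside \<open>A\<close>. It acts on all
  finitely supported functions, so no ambient set of generators enters as a parameter.\<close>

definition frag_restrict :: "'b set \<Rightarrow> ('b \<Rightarrow>\<^sub>0 int) \<Rightarrow> ('b \<Rightarrow>\<^sub>0 int)" where
  "frag_restrict A = frag_extend (\<lambda>x. if x \<in> A then frag_of x else 0)"

lemma frag_restrict_add: "frag_restrict A (c + d) = frag_restrict A c + frag_restrict A d"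
  by (simp add: frag_restrict_def frag_extend_add)

lemma frag_restrict_id:
  assumes "Poly_Mapping.keys c \<subseteq> A" shows "frag_restrict A c = c"
proof -
  have "frag_restrict A c = frag_extend frag_of c"
    unfolding frag_restrict_def using assms by (intro frag_extend_eq) auto
  then show ?thesis using frag_expansion[of c] by simp
qed

lemma frag_restrict_eq_0:
  assumes "Poly_Mapping.keys c \<inter> A = {}" shows "frag_restrict A c = 0"
  unfolding frag_restrict_def using assms by (intro frag_extend_eq_0) auto

section \<open>Homology of complexes of free abelian groups, and its behaviour under direct
  sums\<close>

text \<open>The two assumptions make \<open>d\<close> a group homomorphism. The lemma ensures that
  the subgroup generated by the cycles in \<open>homology\<close> is the set of cycles
  itself.\<close>

lemma free_Abelian_group_kernel:
  fixes d :: "('b \<Rightarrow>\<^sub>0 int) \<Rightarrow> ('c \<Rightarrow>\<^sub>0 int)"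
  assumes add: "\<And>x y. d (x + y) = d x + d y"
    and keys: "\<And>x. Poly_Mapping.keys x \<subseteq> S \<Longrightarrow> Poly_Mapping.keys (d x) \<subseteq> T"
  shows "subgroup (kernel (free_Abelian_group S) (free_Abelian_group T) d) (free_Abelian_group S)"
proof -
  have "d \<in> hom (free_Abelian_group S) (free_Abelian_group T)"
    using keys by (auto intro!: homI simp: add)
  then interpret group_hom "free_Abelian_group S" "free_Abelian_group T" d
    by (simp add: group_hom_def group_hom_axioms_def)
  show ?thesis by (rule subgroup_kernel)
qed

text \<open>Unfolding the quotient turns homology classes into translates of the set of boundaries
  and their product into the elementwise sum. Homology can then be compared by computing with sets
  of chains.\<close>

lemma
  fixes S :: "nat \<Rightarrow> 'b set" and d :: "nat \<Rightarrow> ('b \<Rightarrow>\<^sub>0 int) \<Rightarrow> ('b \<Rightarrow>\<^sub>0 int)"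
  assumes add: "\<And>x y. d n (x + y) = d n x + d n y"
    and keys: "\<And>x. Poly_Mapping.keys x \<subseteq> S n \<Longrightarrow> Poly_Mapping.keys (d n x) \<subseteq> S (n - 1)"
  shows carrier_homology_free_Abelian_group:
      "carrier (homology (\<lambda>n. free_Abelian_group (S n)) d n) =
        (\<lambda>z. (\<lambda>w. d (n + 1) w + z) ` {w. Poly_Mapping.keys w \<subseteq> S (n + 1)}) `
          {z. Poly_Mapping.keys z \<subseteq> S n \<and> d n z = 0}"
    and mult_homology_free_Abelian_group:
      "mult (homology (\<lambda>n. free_Abelian_group (S n)) d n) = (\<lambda>U V. \<Union>u\<in>U. \<Union>v\<in>V. {u + v})"
proof -
  let ?F = "\<lambda>n. free_Abelian_group (S n)"
  have Z: "carrier (subgroup_generated (?F n) (kernel (?F n) (?F (n - 1)) (d n)))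
      = {z. Poly_Mapping.keys z \<subseteq> S n \<and> d n z = 0}"
    using subgroup.carrier_subgroup_generated_subgroup[OF free_Abelian_group_kernel[of "d n", OF add keys]]
    by (auto simp: kernel_def)
  have carrier: "carrier (?F (n + 1)) = {w. Poly_Mapping.keys w \<subseteq> S (n + 1)}"
    by auto
  have coset: "(\<Union>h\<in>d (n + 1) ` W. {h \<otimes>\<^bsub>subgroup_generated (?F n) K\<^esub> z}) = (\<lambda>w. d (n + 1) w + z) ` W"
    for W K z by auto
  show "carrier (homology ?F d n) =
        (\<lambda>z. (\<lambda>w. d (n + 1) w + z) ` {w. Poly_Mapping.keys w \<subseteq> S (n + 1)}) `
          {z. Poly_Mapping.keys z \<subseteq> S n \<and> d n z = 0}"
    unfolding homology_def FactGroup_def RCOSETS_def r_coset_def partial_object.simps Z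
      carrier coset by blast
  show "mult (homology ?F d n) = (\<lambda>U V. \<Union>u\<in>U. \<Union>v\<in>V. {u + v})"
    by (simp add: homology_def FactGroup_def set_mult_def fun_eq_iff)
qed

text \<open>The isomorphism is the pair of restrictions, applied to cosets elementwise.\<close>

lemma homology_free_Abelian_group_Un:
  fixes A B :: "nat \<Rightarrow> 'b set" and d :: "nat \<Rightarrow> ('b \<Rightarrow>\<^sub>0 int) \<Rightarrow> ('b \<Rightarrow>\<^sub>0 int)"
  assumes disjoint: "\<And>n. A n \<inter> B n = {}"
    and add: "\<And>n x y. d n (x + y) = d n x + d n y"
    and A: "\<And>n x. Poly_Mapping.keys x \<subseteq> A n \<Longrightarrow> Poly_Mapping.keys (d n x) \<subseteq> A (n - 1)"
    and B: "\<And>n x. Poly_Mapping.keys x \<subseteq> B n \<Longrightarrow> Poly_Mapping.keys (d n x) \<subseteq> B (n - 1)"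
  shows "homology (\<lambda>n. free_Abelian_group (A n \<union> B n)) d n \<cong>
    homology (\<lambda>n. free_Abelian_group (A n)) d n \<times>\<times> homology (\<lambda>n. free_Abelian_group (B n)) d n"
    (is "?H \<cong> ?HA \<times>\<times> ?HB")
proof -
  let ?K = "Poly_Mapping.keys"
  let ?p = "frag_restrict (A n)" and ?q = "frag_restrict (B n)"
  have AB: "?K (d n x) \<subseteq> A (n - 1) \<union> B (n - 1)" if "?K x \<subseteq> A n \<union> B n" for n x
  proof -
    obtain a b where "?K a \<subseteq> A n" "?K b \<subseteq> B n" "a + b = x"
      using frag_split[OF \<open>?K x \<subseteq> A n \<union> B n\<close>] by blast
    then show ?thesis
      using A[of a n] B[of b n] Poly_Mapping.keys_add[of "d n a" "d n b"] by (auto simp: add)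
  qed
  \<comment> \<open>Disjointness of \<open>A n\<close> and \<open>B n\<close>: each projection fixes
    one summand and kills the other.\<close>
  have pq: "?p (a + b) = a" "?q (a + b) = b" if "?K a \<subseteq> A n" "?K b \<subseteq> B n" for a b
  proof -
    have "?K b \<inter> A n = {}" "?K a \<inter> B n = {}" using that disjoint[of n] by auto
    then show "?p (a + b) = a" "?q (a + b) = b"
      using that by (simp_all add: frag_restrict_add frag_restrict_id frag_restrict_eq_0)
  qed
  \<comment> \<open>The classes of \<open>z\<close> in the two summands and in the whole complex, in
    the shape that the description of the carrier gives.\<close>
  define cA where "cA z = (\<lambda>w. d (n + 1) w + z) ` {w. ?K w \<subseteq> A (n + 1)}" for z
  define cB where "cB z = (\<lambda>w. d (n + 1) w + z) ` {w. ?K w \<subseteq> B (n + 1)}" for z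
  define c where "c z = (\<lambda>w. d (n + 1) w + z) ` {w. ?K w \<subseteq> A (n + 1) \<union> B (n + 1)}" for z
  define ZA where "ZA = {z. ?K z \<subseteq> A n \<and> d n z = 0}"
  define ZB where "ZB = {z. ?K z \<subseteq> B n \<and> d n z = 0}"
  have dA: "?K (d (n + 1) w) \<subseteq> A n" if "?K w \<subseteq> A (n + 1)" for w
    using A[OF that] by simp
  have dB: "?K (d (n + 1) w) \<subseteq> B n" if "?K w \<subseteq> B (n + 1)" for w
    using B[OF that] by simp
  \<comment> \<open>A chain \<open>w\<close> of degree \<open>n + 1\<close> splits along
    \<open>A\<close> and \<open>B\<close>, and so does its boundary; a class of the sum is therefore
    the elementwise sum of two classes.\<close>
  have c_eq: "c (a + b) = {u + v |u v. u \<in> cA a \<and> v \<in> cB b}" for a b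
  proof (intro Set.set_eqI iffI)
    fix x assume "x \<in> c (a + b)"
    then obtain w where w: "?K w \<subseteq> A (n + 1) \<union> B (n + 1)" "x = d (n + 1) w + (a + b)"
      by (auto simp: c_def)
    obtain w1 w2 where "?K w1 \<subseteq> A (n + 1)" "?K w2 \<subseteq> B (n + 1)" "w1 + w2 = w"
      using frag_split[OF w(1)] by blast
    moreover from this have "x = (d (n + 1) w1 + a) + (d (n + 1) w2 + b)"
      using w(2) by (auto simp: add algebra_simps)
    ultimately show "x \<in> {u + v |u v. u \<in> cA a \<and> v \<in> cB b}"
      unfolding cA_def cB_def by blast
  next
    fix x assume "x \<in> {u + v |u v. u \<in> cA a \<and> v \<in> cB b}"
    then obtain w1 w2 where w: "?K w1 \<subseteq> A (n + 1)" "?K w2 \<subseteq> B (n + 1)"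
      "x = (d (n + 1) w1 + a) + (d (n + 1) w2 + b)"
      by (auto simp: cA_def cB_def)
    then have "x = d (n + 1) (w1 + w2) + (a + b)" by (simp add: add algebra_simps)
    moreover have "?K (w1 + w2) \<subseteq> A (n + 1) \<union> B (n + 1)"
      using w Poly_Mapping.keys_add[of w1 w2] by auto
    ultimately show "x \<in> c (a + b)" unfolding c_def by blast
  qed
  have cA_sub: "?K u \<subseteq> A n" if "u \<in> cA a" "a \<in> ZA" for u a
  proof -
    obtain w where "u = d (n + 1) w + a" "?K w \<subseteq> A (n + 1)" using \<open>u \<in> cA a\<close> by (auto simp: cA_def)
    then show ?thesis
      using Poly_Mapping.keys_add[of "d (n + 1) w" a] dA[of w] \<open>a \<in> ZA\<close> unfolding ZA_def by blast
  qed
  have cB_sub: "?K u \<subseteq> B n" if "u \<in> cB b" "b \<in> ZB" for u b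
  proof -
    obtain w where "u = d (n + 1) w + b" "?K w \<subseteq> B (n + 1)" using \<open>u \<in> cB b\<close> by (auto simp: cB_def)
    then show ?thesis
      using Poly_Mapping.keys_add[of "d (n + 1) w" b] dB[of w] \<open>b \<in> ZB\<close> unfolding ZB_def by blast
  qed
  \<comment> \<open>Witness \<open>w = 0\<close>. Projecting an elementwise sum to one factor
    recovers that factor only if the other one is nonempty.\<close>
  have ne: "cA a \<noteq> {}" "cB b \<noteq> {}" for a b
    unfolding cA_def cB_def by (auto intro: exI[of _ 0])
  have p_c: "?p ` c (a + b) = cA a" if "a \<in> ZA" "b \<in> ZB" for a b
  proof -
    have "?p (u + v) = u" if "u \<in> cA a" "v \<in> cB b" for u v
      using that \<open>a \<in> ZA\<close> \<open>b \<in> ZB\<close> by (intro pq(1) cA_sub cB_sub)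
    then have "?p ` c (a + b) = {u |u v. u \<in> cA a \<and> v \<in> cB b}"
      unfolding c_eq by (auto simp: image_iff) metis+
    then show ?thesis using ne(2)[of b] by auto
  qed
  have q_c: "?q ` c (a + b) = cB b" if "a \<in> ZA" "b \<in> ZB" for a b
  proof -
    have "?q (u + v) = v" if "u \<in> cA a" "v \<in> cB b" for u v
      using that \<open>a \<in> ZA\<close> \<open>b \<in> ZB\<close> by (intro pq(2) cA_sub cB_sub)
    then have "?q ` c (a + b) = {v |u v. u \<in> cA a \<and> v \<in> cB b}"
      unfolding c_eq by (auto simp: image_iff) metis+
    then show ?thesis using ne(1)[of a] by auto
  qed
  \<comment> \<open>Cycles split as well: if \<open>d n a + d n b = 0\<close>, then
    \<open>d n a\<close> and \<open>d n b\<close> have the same support, which lies in both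
    \<open>A (n - 1)\<close> and \<open>B (n - 1)\<close> and so is empty.\<close>
  have Z: "{z. ?K z \<subseteq> A n \<union> B n \<and> d n z = 0} = {a + b |a b. a \<in> ZA \<and> b \<in> ZB}"
  proof (intro Set.set_eqI iffI)
    fix z assume "z \<in> {z. ?K z \<subseteq> A n \<union> B n \<and> d n z = 0}"
    then have z: "?K z \<subseteq> A n \<union> B n" "d n z = 0" by auto
    obtain a b where ab: "?K a \<subseteq> A n" "?K b \<subseteq> B n" "a + b = z"
      using frag_split[OF z(1)] by blast
    have sum: "d n a + d n b = 0" using z ab add by metis
    have "?K (d n b) = ?K (d n a)"
      using sum by (metis add_eq_0_iff keys_minus)
    then have "?K (d n a) \<subseteq> A (n - 1) \<inter> B (n - 1)"
      using A[OF ab(1)] B[OF ab(2)] by auto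
    then have "?K (d n a) = {}" using disjoint[of "n - 1"] by blast
    then have "d n a = 0" by simp
    then show "z \<in> {a + b |a b. a \<in> ZA \<and> b \<in> ZB}" using ab sum by (auto simp: ZA_def ZB_def)
  next
    fix z assume "z \<in> {a + b |a b. a \<in> ZA \<and> b \<in> ZB}"
    then obtain a b where "z = a + b" "a \<in> ZA" "b \<in> ZB" by blast
    then show "z \<in> {z. ?K z \<subseteq> A n \<union> B n \<and> d n z = 0}"
      using Poly_Mapping.keys_add[of a b] by (auto simp: ZA_def ZB_def add)
  qed
  have "carrier ?H = c ` {z. ?K z \<subseteq> A n \<union> B n \<and> d n z = 0}"
    using carrier_homology_free_Abelian_group[of d n "\<lambda>n. A n \<union> B n", OF add AB]
    by (simp add: c_def [abs_def])
  then have H: "carrier ?H = {c (a + b) |a b. a \<in> ZA \<and> b \<in> ZB}"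
    unfolding Z by auto
  have HA: "carrier ?HA = cA ` ZA"
    using carrier_homology_free_Abelian_group[of d n A, OF add A]
    by (simp add: cA_def [abs_def] ZA_def)
  have HB: "carrier ?HB = cB ` ZB"
    using carrier_homology_free_Abelian_group[of d n B, OF add B]
    by (simp add: cB_def [abs_def] ZB_def)
  note m = mult_homology_free_Abelian_group[of d n "\<lambda>n. A n \<union> B n", OF add AB]
    mult_homology_free_Abelian_group[of d n A, OF add A]
    mult_homology_free_Abelian_group[of d n B, OF add B]
  define f where "f W = (?p ` W, ?q ` W)" for W
  have f: "f (c (a + b)) = (cA a, cB b)" if "a \<in> ZA" "b \<in> ZB" for a b
    using that by (simp add: f_def p_c q_c)
  have "f \<in> hom ?H (?HA \<times>\<times> ?HB)"
  proof (rule homI)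
    show "f x \<in> carrier (?HA \<times>\<times> ?HB)" if "x \<in> carrier ?H" for x
      using that by (auto simp: H HA HB f)
    \<comment> \<open>Both projections are additive, so taking images commutes with elementwise
      sums, which are the products in all three groups.\<close>
    show "f (x \<otimes>\<^bsub>?H\<^esub> y) = f x \<otimes>\<^bsub>?HA \<times>\<times> ?HB\<^esub> f y" for x y
      by (simp add: f_def m image_UN frag_restrict_add)
  qed
  moreover have "bij_betw f (carrier ?H) (carrier (?HA \<times>\<times> ?HB))"
  proof (intro bij_betw_imageI inj_onI)
    fix x y assume "x \<in> carrier ?H" "y \<in> carrier ?H" "f x = f y"
    then obtain a b a' b' where "a \<in> ZA" "b \<in> ZB" "a' \<in> ZA" "b' \<in> ZB"
      and xy: "x = c (a + b)" "y = c (a' + b')" unfolding H by blast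
    then have "cA a = cA a'" "cB b = cB b'" using \<open>f x = f y\<close> f by auto
    \<comment> \<open>By \<open>c_eq\<close> a class of the sum is determined by its two
      components.\<close>
    then show "x = y" by (simp add: xy c_eq)
  next
    show "f ` carrier ?H = carrier (?HA \<times>\<times> ?HB)"
    proof
      show "f ` carrier ?H \<subseteq> carrier (?HA \<times>\<times> ?HB)" by (auto simp: H HA HB f)
      show "carrier (?HA \<times>\<times> ?HB) \<subseteq> f ` carrier ?H"
      proof
        fix y assume "y \<in> carrier (?HA \<times>\<times> ?HB)"
        then obtain a b where "a \<in> ZA" "b \<in> ZB" "y = (cA a, cB b)" by (auto simp: HA HB)
        then have "y = f (c (a + b))" "c (a + b) \<in> carrier ?H"
          unfolding H by (simp_all add: f) blast
        then show "y \<in> f ` carrier ?H" by blast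
      qed
    qed
  qed
  ultimately show ?thesis by (auto simp: is_iso_def iso_def)
qed

section \<open>Subgroups generated by basis elements\<close>

text \<open>The chains supported in \<open>A\<close> form a subgroup containing the generators, and
  induction on chains builds each of them from generators by differences. An equality of groups, not
  merely an isomorphism, allows rewriting inside \<open>homology\<close>.\<close>

lemma subgroup_generated_free_Abelian_group:
  assumes "A \<subseteq> S"
  shows "subgroup_generated (free_Abelian_group S) (frag_of ` A) = free_Abelian_group A"
proof -
  have sub: "subgroup (carrier (free_Abelian_group A)) (free_Abelian_group S)"
  proof (rule group.subgroupI)
    show "carrier (free_Abelian_group A) \<subseteq> carrier (free_Abelian_group S)"
      using assms by auto
    have "0 \<in> carrier (free_Abelian_group A)" by simp
    then show "carrier (free_Abelian_group A) \<noteq> {}" by blast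
    fix a b assume a: "a \<in> carrier (free_Abelian_group A)" and b: "b \<in> carrier (free_Abelian_group A)"
    show "inv\<^bsub>free_Abelian_group S\<^esub> a \<in> carrier (free_Abelian_group A)"
      using a assms by (subst inv_free_Abelian_group) auto
    show "a \<otimes>\<^bsub>free_Abelian_group S\<^esub> b \<in> carrier (free_Abelian_group A)"
      using a b Poly_Mapping.keys_add[of a b] by auto
  qed simp
  let ?G = "subgroup_generated (free_Abelian_group S) (frag_of ` A)"
  have gen: "x \<in> carrier ?G" if "x \<in> frag_of ` A" for x
    using that assms by (auto simp: carrier_subgroup_generated intro!: generate.incl)
  interpret G: group ?G
    by (simp add: group.group_subgroup_generated)
  have "c \<in> carrier ?G" if "Poly_Mapping.keys c \<subseteq> A" for c
    using that
  proof (induction c rule: frag_induction)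
    case zero
    show ?case using G.one_closed by simp
  next
    case (one x)
    then show ?case using gen by blast
  next
    case (diff a b)
    \<comment> \<open>The identification of the group inverse with negation is available for chains
      supported in \<open>S\<close>.\<close>
    have "Poly_Mapping.keys b \<subseteq> S"
      using subsetD[OF group.carrier_subgroup_generated_subset[OF group_free_Abelian_group] diff.IH(2)]
      by simp
    then have "inv\<^bsub>?G\<^esub> b = - b"
      using group.inv_subgroup_generated[OF group_free_Abelian_group diff.IH(2)] by simp
    then show ?case using G.m_closed[OF diff.IH(1) G.inv_closed[OF diff.IH(2)]] by simp
  qed
  then have "carrier (free_Abelian_group A) \<subseteq> carrier ?G"
    by auto
  moreover have "frag_of ` A \<subseteq> carrier (free_Abelian_group A)"
    by auto
  then have "carrier ?G \<subseteq> carrier (free_Abelian_group A)"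
    by (intro group.subgroup_generated_minimal sub) auto
  ultimately have "carrier ?G = carrier (free_Abelian_group A)"
    by (rule subset_antisym[rotated])
  \<comment> \<open>Both groups carry addition and the zero chain, so equal carriers make the
    records equal.\<close>
  then show ?thesis
    by (simp add: subgroup_generated_def free_Abelian_group_def)
qed

section \<open>Faces of tuples and supports of boundaries\<close>

text \<open>Call entries \<open>2 * j\<close> and \<open>2 * j + 1\<close> the pair
  \<open>j\<close>. Deleting pair \<open>i\<close> keeps the earlier pairs in place and moves the
  later ones down by one, leaving \<open>n - 2\<close> pairs.\<close>

lemma entry_omit_face:
  assumes "length xs + 1 = 2 * n" "i \<in> {1..n - 1}" "1 \<le> j" "j \<le> n - 2"
  shows "entry (omit_face i xs) (2 * j) = entry xs (2 * (if j < i then j else j + 1))"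
    and "entry (omit_face i xs) (2 * j + 1) = entry xs (2 * (if j < i then j else j + 1) + 1)"
  using assms by (auto simp: omit_face_def nth_append intro!: arg_cong[of _ _ "nth xs"])

text \<open>The translated segment ends at entry \<open>2 * i - 1\<close>, the second entry of pair
  \<open>i - 1\<close> when \<open>i > 1\<close>. Hence every remaining pair is translated as a
  whole or not at all.\<close>

lemma entry_act_face:
  assumes "length xs + 1 = 2 * n" "i \<in> {1..n - 1}" "1 \<le> j" "j \<le> n - 2"
  shows "entry (act_face t i xs) (2 * j) =
      (if j < i then t (entry xs (2 * j)) (entry xs (2 * i)) (entry xs (2 * i + 1))
       else entry xs (2 * (j + 1)))"
    and "entry (act_face t i xs) (2 * j + 1) =
      (if j < i then t (entry xs (2 * j + 1)) (entry xs (2 * i)) (entry xs (2 * i + 1))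
       else entry xs (2 * (j + 1) + 1))"
  using assms by (auto simp: act_face_def nth_append intro!: arg_cong[of _ _ "nth xs"])

text \<open>The condition on generators in \<open>DH_chain\<close>, and negated the one in
  \<open>NDH_chain\<close>. For \<open>n = 1\<close> the range is empty, so all 1-tuples are
  nondegenerate.\<close>

definition degenerate :: "nat \<Rightarrow> 'a list \<Rightarrow> bool" where
  "degenerate n xs \<longleftrightarrow> (\<exists>i\<in>{1..n - 1}. entry xs (2 * i) = entry xs (2 * i + 1))"

lemma entry_mem:
  assumes "xs \<in> SD_tuples X n" "i \<in> {1..n - 1}"
  shows "entry xs (2 * i) \<in> X" "entry xs (2 * i + 1) \<in> X"
  using assms by (auto simp: SD_tuples_def subset_iff intro!: nth_mem)

lemma omit_face_in_SD_tuples: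
  assumes "xs \<in> SD_tuples X n" "i \<in> {1..n - 1}"
  shows "omit_face i xs \<in> SD_tuples X (n - 1)"
  using assms by (auto simp: SD_tuples_def omit_face_def dest: in_set_takeD in_set_dropD)

text \<open>The two faces at \<open>i\<close> enter the boundary with opposite signs, so they may
  lie outside \<open>T\<close> as long as they cancel. The disjunction serves both
  subcomplexes.\<close>

lemma keys_SD_boundary:
  assumes "Poly_Mapping.keys c \<subseteq> S"
    and "\<And>xs i. \<lbrakk>xs \<in> S; i \<in> {1..n - 1}\<rbrakk> \<Longrightarrow>
      omit_face i xs = act_face t i xs \<or> omit_face i xs \<in> T \<and> act_face t i xs \<in> T"
  shows "Poly_Mapping.keys (SD_boundary t n c) \<subseteq> T"
proof -
  have "Poly_Mapping.keys (frag_cmul ((-1) ^ i) (frag_of (omit_face i xs) - frag_of (act_face t i xs))) \<subseteq> T"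
    if "xs \<in> S" "i \<in> {1..n - 1}" for xs i
    using assms(2)[OF that] keys_cmul[of "(-1) ^ i" "frag_of (omit_face i xs) - frag_of (act_face t i xs)"]
      keys_diff[of "frag_of (omit_face i xs)" "frag_of (act_face t i xs)"]
    by auto
  then have "Poly_Mapping.keys (\<Sum>i = 1..n - 1.
      frag_cmul ((-1) ^ i) (frag_of (omit_face i xs) - frag_of (act_face t i xs))) \<subseteq> T"
    if "xs \<in> S" for xs
    using that by (intro order_trans[OF keys_sum] UN_least)
  then show ?thesis
    unfolding SD_boundary_def using assms(1)
    by (intro order_trans[OF keys_frag_extend] UN_least) auto
qed

section \<open>Degeneracy of faces in a heap\<close>

context heap
begin

text \<open>Translation by \<open>(a, b)\<close> is undone by translation by
  \<open>(b, a)\<close>.\<close>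

lemma translate_eq_iff:
  assumes "x \<in> X" "y \<in> X" "a \<in> X" "b \<in> X"
  shows "t x a b = t y a b \<longleftrightarrow> x = y"
proof -
  have "t (t z a b) b a = z" if "z \<in> X" for z
    using that assms by (simp add: assoc_left assoc_right cancel_left cancel_right)
  then show ?thesis using assms by metis
qed

lemma act_face_in_SD_tuples:
  assumes "xs \<in> SD_tuples X n" "i \<in> {1..n - 1}"
  shows "act_face t i xs \<in> SD_tuples X (n - 1)"
proof -
  have "t x (entry xs (2 * i)) (entry xs (2 * i + 1)) \<in> X" if "x \<in> set xs" for x
    using that assms entry_mem[OF assms] by (intro closed) (auto simp: SD_tuples_def)
  then show ?thesis
    using assms by (auto simp: SD_tuples_def act_face_def dest: in_set_takeD in_set_dropD)
qed

lemma nondegenerate_faces: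
  assumes xs: "xs \<in> SD_tuples X n" and i: "i \<in> {1..n - 1}" and nondeg: "\<not> degenerate n xs"
  shows "\<not> degenerate (n - 1) (omit_face i xs)" "\<not> degenerate (n - 1) (act_face t i xs)"
proof -
  have len: "length xs + 1 = 2 * n" using xs by (simp add: SD_tuples_def)
  have ne: "entry xs (2 * j) \<noteq> entry xs (2 * j + 1)" if "1 \<le> j" "j \<le> n - 1" for j
    using that nondeg unfolding degenerate_def by auto
  have "entry (omit_face i xs) (2 * j) \<noteq> entry (omit_face i xs) (2 * j + 1)"
    "entry (act_face t i xs) (2 * j) \<noteq> entry (act_face t i xs) (2 * j + 1)"
    if j: "1 \<le> j" "j \<le> n - 2" for j
  proof -
    have j': "j \<in> {1..n - 1}" using j by auto
    show "entry (omit_face i xs) (2 * j) \<noteq> entry (omit_face i xs) (2 * j + 1)"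
      unfolding entry_omit_face[OF len i j] using j by (intro ne) auto
    show "entry (act_face t i xs) (2 * j) \<noteq> entry (act_face t i xs) (2 * j + 1)"
      unfolding entry_act_face[OF len i j]
      \<comment> \<open>For \<open>j < i\<close> both entries of pair \<open>j\<close> undergo the
        same injective translation; otherwise the pair is the untouched pair \<open>j + 1\<close> of
        \<open>xs\<close>.\<close>
      using ne[of j] ne[of "j + 1"] j translate_eq_iff[OF entry_mem[OF xs j'] entry_mem[OF xs i]]
      by (auto split: if_splits)
  qed
  then show "\<not> degenerate (n - 1) (omit_face i xs)" "\<not> degenerate (n - 1) (act_face t i xs)"
    \<comment> \<open>Rewriting 2 as a successor reconciles the bound \<open>n - 1 - 1\<close> from
      the definition with \<open>n - 2\<close>.\<close>
    unfolding degenerate_def by (auto simp: numeral_2_eq_2)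
qed

lemma degenerate_faces:
  assumes xs: "xs \<in> SD_tuples X n" and i: "i \<in> {1..n - 1}" and deg: "degenerate n xs"
  shows "omit_face i xs = act_face t i xs \<or>
    degenerate (n - 1) (omit_face i xs) \<and> degenerate (n - 1) (act_face t i xs)"
proof -
  obtain k where k: "k \<in> {1..n - 1}" "entry xs (2 * k) = entry xs (2 * k + 1)"
    using deg by (auto simp: degenerate_def)
  have len: "length xs + 1 = 2 * n" using xs by (simp add: SD_tuples_def)
  show ?thesis
  proof (cases "k = i")
    case True
    have "t x (entry xs (2 * i)) (entry xs (2 * i + 1)) = x" if "x \<in> set (take (2 * i - 1) xs)" for x
      using that xs k(2) cancel_right[OF _ entry_mem(2)[OF xs i]]
      by (auto simp: True SD_tuples_def dest!: in_set_takeD)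
    then have "omit_face i xs = act_face t i xs"
      by (simp add: omit_face_def act_face_def map_idI)
    then show ?thesis ..
  next
    case False
    \<comment> \<open>The position that the equal pair \<open>k\<close> takes once pair
      \<open>i\<close> is deleted, inverting the reindexing of the face lemmas.\<close>
    define j where "j = (if k < i then k else k - 1)"
    have j: "1 \<le> j" "j \<le> n - 2" and k_j: "k = (if j < i then j else j + 1)"
      using False k i by (auto simp: j_def)
    have "entry (omit_face i xs) (2 * j) = entry (omit_face i xs) (2 * j + 1)"
      using k(2) unfolding entry_omit_face[OF len i j] k_j .
    moreover have "entry (act_face t i xs) (2 * j) = entry (act_face t i xs) (2 * j + 1)"
      using k(2) unfolding entry_act_face[OF len i j] k_j by (auto split: if_splits)
    moreover have "j \<in> {1..n - 1 - 1}" using j by auto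
    ultimately show ?thesis unfolding degenerate_def by blast
  qed
qed

end

theorem proposition3p9:
  fixes X :: "'a set" and t :: "'a \<Rightarrow> 'a \<Rightarrow> 'a \<Rightarrow> 'a" and n :: nat
  assumes "heap X t" and "n \<ge> 1"
  shows "SD_homology X t n \<cong> DH_homology X t n \<times>\<times> NDH_homology X t n"
proof -
  interpret heap X t by fact
  define A where "A n = {xs \<in> SD_tuples X n. degenerate n xs}" for n
  define B where "B n = {xs \<in> SD_tuples X n. \<not> degenerate n xs}" for n
  \<comment> \<open>The identifications are equalities of whole families, since homology in degree
    \<open>n\<close> also involves degrees \<open>n - 1\<close> and \<open>n + 1\<close>.\<close>
  have SD: "SD_chain X = (\<lambda>n. free_Abelian_group (A n \<union> B n))"
    by (auto simp: SD_chain_def A_def B_def fun_eq_iff intro!: arg_cong[of _ _ free_Abelian_group])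
  have DH: "DH_chain X = (\<lambda>n. free_Abelian_group (A n))"
    unfolding DH_chain_def SD_chain_def A_def degenerate_def
    by (intro ext subgroup_generated_free_Abelian_group) auto
  have NDH: "NDH_chain X = (\<lambda>n. free_Abelian_group (B n))"
    unfolding NDH_chain_def SD_chain_def B_def degenerate_def
    by (intro ext) (simp add: subgroup_generated_free_Abelian_group)
  show ?thesis
    unfolding SD_homology_def DH_homology_def NDH_homology_def SD DH NDH
  proof (rule homology_free_Abelian_group_Un)
    show "A n \<inter> B n = {}" for n by (auto simp: A_def B_def)
    show "SD_boundary t n (x + y) = SD_boundary t n x + SD_boundary t n y" for n x y
      by (simp add: SD_boundary_def frag_extend_add)
    show "Poly_Mapping.keys (SD_boundary t n x) \<subseteq> A (n - 1)" if "Poly_Mapping.keys x \<subseteq> A n" for n x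
      using that
    proof (rule keys_SD_boundary)
      fix xs i assume "xs \<in> A n" and i: "i \<in> {1..n - 1}"
      then have "xs \<in> SD_tuples X n" "degenerate n xs" by (auto simp: A_def)
      from degenerate_faces[OF this(1) i this(2)] omit_face_in_SD_tuples[OF this(1) i]
        act_face_in_SD_tuples[OF this(1) i]
      show "omit_face i xs = act_face t i xs \<or> omit_face i xs \<in> A (n - 1) \<and> act_face t i xs \<in> A (n - 1)"
        by (auto simp: A_def)
    qed
    show "Poly_Mapping.keys (SD_boundary t n x) \<subseteq> B (n - 1)" if "Poly_Mapping.keys x \<subseteq> B n" for n x
      using that
    proof (rule keys_SD_boundary)
      fix xs i assume "xs \<in> B n" and i: "i \<in> {1..n - 1}"
      then have "xs \<in> SD_tuples X n" "\<not> degenerate n xs" by (auto simp: B_def)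
      from nondegenerate_faces[OF this(1) i this(2)] omit_face_in_SD_tuples[OF this(1) i]
        act_face_in_SD_tuples[OF this(1) i]
      show "omit_face i xs = act_face t i xs \<or> omit_face i xs \<in> B (n - 1) \<and> act_face t i xs \<in> B (n - 1)"
        by (auto simp: B_def)
    qed
  qed
qed

end
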